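(* Let a rotor-router network be imposed on a digraph $G=(V,E)$ with $m$ non-target vertices, all rotors of type $r$. Suppose that every directed cycle in $G$ contains the source of the network, and that $d$ is the largest number of non-target vertices in a simple directed path in $G$ beginning at the source. Then the hitting sequence of the network has period length at most $|r|^d$.
   Context: A rotor type is an infinite periodic sequence $r=(r^{(1)},r^{(2)},\dots)$ of natural numbers (states), with (fundamental) period $|r|$. A rotor-router network consists of a finite digraph (loops and multiple edges allowed), a source vertex, a set of target vertices of outdegree $0$ such that every non-target vertex can reach a target, and at each non-target vertex $v$ a periodic sequence $e_v^{(1)},e_v^{(2)},\dots$ of out-edges of $v$. A particle starts at the source; on its $n$-th visit to a non-target vertex $v$ it leaves along $e_v^{(n)}$; whenever it reaches a target it is returned to the source and continues. The hitting sequence is the sequence of targets successively reached (it is periodic). A non-target vertex $v$ has a rotor of type $r$ if $e_v^{(n)}=\phi_v(r^{(n)})$ for all $n$, for some injective map $\phi_v$ from the states of $r$ to out-edges of $v$. *)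

theory Defs
  imports "HOL-Library.Infinite_Set" "Graph_Theory.Graph_Theory"
begin

text \<open>
  All sequences are indexed from 0: the mathematical \<open>x\<^sup>(\<^sup>n\<^sup>)\<close> with \<open>n \<ge> 1\<close> is
  \<open>x (n - 1)\<close> here. Periodicity is pure periodicity, from the first term on.
\<close>

definition periodic :: "(nat \<Rightarrow> 'a) \<Rightarrow> bool" where
  "periodic x \<longleftrightarrow> (\<exists>p>0. \<forall>n. x (n + p) = x n)"

text \<open>Meaningful only for periodic sequences.\<close>

definition fundamental_period :: "(nat \<Rightarrow> 'a) \<Rightarrow> nat" where
  "fundamental_period x = (LEAST p. 0 < p \<and> (\<forall>n. x (n + p) = x n))"

text \<open>
  \<open>rotor v n\<close> is the arc along which the particle leaves the non-target vertex \<open>v\<close> on its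
  \<open>(n + 1)\<close>-st visit; \<open>rotor v\<close> is irrelevant for all other \<open>v\<close>. Loops and multiple arcs are
  allowed by \<open>fin_digraph\<close>. A rotor is not required to use every out-arc of its vertex.
\<close>

locale rotor_router_network = fin_digraph G
  for G :: "('v, 'e) pre_digraph" (structure) +
  fixes source :: 'v and targets :: "'v set" and rotor :: "'v \<Rightarrow> nat \<Rightarrow> 'e"
  assumes source_in_verts: "source \<in> verts G"
    and targets_in_verts: "targets \<subseteq> verts G"
    and target_sink: "t \<in> targets \<Longrightarrow> out_degree G t = 0"
    and target_reachable: "v \<in> verts G - targets \<Longrightarrow> \<exists>t\<in>targets. v \<rightarrow>\<^sup>*\<^bsub>G\<^esub> t"
    and rotor_periodic: "v \<in> verts G - targets \<Longrightarrow> periodic (rotor v)"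
    and rotor_out_arcs: "v \<in> verts G - targets \<Longrightarrow> rotor v n \<in> out_arcs G v"

definition (in rotor_router_network) has_rotor_of_type :: "(nat \<Rightarrow> nat) \<Rightarrow> 'v \<Rightarrow> bool" where
  "has_rotor_of_type r v \<longleftrightarrow>
     (\<exists>\<phi>. inj_on \<phi> (range r) \<and> \<phi> ` range r \<subseteq> out_arcs G v \<and> (\<forall>n. rotor v n = \<phi> (r n)))"

context rotor_router_network
begin

text \<open>
  The state after \<open>n\<close> steps: the position of the particle, and for every vertex the number of
  times the particle has left it along its rotor so far. The return from a target to the source
  counts as a step of its own.
\<close>

primrec state :: "nat \<Rightarrow> 'v \<times> ('v \<Rightarrow> nat)" where
  "state 0 = (source, \<lambda>_. 0)"
| "state (Suc n) =
     (case state n of (v, c) \<Rightarrow>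
        if v \<in> targets then (source, c)
        else (head G (rotor v (c v)), c(v := Suc (c v))))"

definition position :: "nat \<Rightarrow> 'v" where
  "position n = fst (state n)"

text \<open>
  \<open>h\<close> is the infinite sequence of targets reached by the particle, in order. It is unique if it
  exists, and it exists if and only if the particle reaches a target infinitely often.
\<close>

definition is_hitting_sequence :: "(nat \<Rightarrow> 'v) \<Rightarrow> bool" where
  "is_hitting_sequence h \<longleftrightarrow>
     (\<exists>\<tau>. strict_mono \<tau> \<and> range \<tau> = {n. position n \<in> targets} \<and> h = position \<circ> \<tau>)"

lemma hitting_sequence_unique:
  assumes "is_hitting_sequence h" "is_hitting_sequence h'"
  shows "h = h'"
proof -
  obtain \<tau> \<tau>' where \<tau>: "strict_mono \<tau>" "range \<tau> = {n. position n \<in> targets}" "h = position \<circ> \<tau>"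
    and \<tau>': "strict_mono \<tau>'" "range \<tau>' = {n. position n \<in> targets}" "h' = position \<circ> \<tau>'"
    using assms unfolding is_hitting_sequence_def by blast
  have le: "g n \<le> f n"
    if f: "strict_mono f" and g: "strict_mono g" and ran: "range f = range g"
      and IH: "\<And>j. j < n \<Longrightarrow> f j = g j"
    for f g :: "nat \<Rightarrow> nat" and n
  proof -
    obtain j where j: "f n = g j" using ran by (metis rangeE rangeI)
    have "\<not> j < n"
    proof
      assume "j < n"
      then have "f n = f j" using IH j by simp
      then show False using f \<open>j < n\<close> by (simp add: strict_mono_eq)
    qed
    then show ?thesis using j g by (simp add: strict_mono_less_eq)
  qed
  have "\<tau> n = \<tau>' n" for n
  proof (induction n rule: less_induct)
    case (less n)
    show ?case
      using le[OF \<tau>(1) \<tau>'(1) _ less] le[OF \<tau>'(1) \<tau>(1) _ less[symmetric]] \<tau>(2) \<tau>'(2)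
      by (simp add: le_antisym)
  qed
  then show ?thesis using \<tau>(3) \<tau>'(3) by (simp add: fun_eq_iff)
qed

lemma hitting_sequence_iff_infinite:
  "(\<exists>h. is_hitting_sequence h) \<longleftrightarrow> infinite {n. position n \<in> targets}"
proof
  assume "\<exists>h. is_hitting_sequence h"
  then show "infinite {n. position n \<in> targets}"
    unfolding is_hitting_sequence_def
    by (metis finite_imageD infinite_UNIV_nat strict_mono_imp_inj_on)
next
  assume "infinite {n. position n \<in> targets}"
  then show "\<exists>h. is_hitting_sequence h"
    unfolding is_hitting_sequence_def
    by (metis range_enumerate strict_mono_enumerate)
qed

lemma position_Suc:
  "position (Suc n) = (if position n \<in> targets then source
     else head G (rotor (position n) (snd (state n) (position n))))"
  by (auto simp: position_def split: prod.splits)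

lemma count_Suc:
  "snd (state (Suc n)) v = snd (state n) v + (if position n = v \<and> v \<notin> targets then 1 else 0)"
  by (auto simp: position_def split: prod.splits)

lemma count_card:
  "snd (state n) v = card {k. k < n \<and> position k = v \<and> v \<notin> targets}"
proof (induction n)
  case (Suc n)
  have "{k. k < Suc n \<and> position k = v \<and> v \<notin> targets} =
    (if position n = v \<and> v \<notin> targets then insert n else id)
       {k. k < n \<and> position k = v \<and> v \<notin> targets}"
    by (auto simp: less_Suc_eq)
  then show ?case using Suc by (simp add: count_Suc del: state.simps)
qed simp

lemma position_in_verts: "position n \<in> verts G"
proof (induction n)
  case 0
  show ?case by (simp add: position_def source_in_verts)
next
  case (Suc n)
  then show ?case
    using rotor_out_arcs[of "position n"] by (auto simp: position_Suc source_in_verts)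
qed

lemma visit_with_count:
  assumes inf: "infinite {n. position n = v}" and v: "v \<notin> targets"
  shows "\<exists>n. position n = v \<and> snd (state n) v = k"
proof -
  obtain B where B: "finite B" "card B = Suc k" "B \<subseteq> {n. position n = v}"
    using infinite_arbitrarily_large[OF inf] by blast
  obtain N where N: "\<And>x. x \<in> B \<Longrightarrow> x < N"
    using B(1) by (meson finite_nat_set_iff_bounded)
  have "card B \<le> snd (state N) v"
    unfolding count_card using B N v by (intro card_mono) auto
  then have ex: "k < snd (state N) v" using B(2) by simp
  define n where "n = (LEAST n. k < snd (state n) v)"
  have n: "k < snd (state n) v" unfolding n_def using ex by (rule LeastI)
  then obtain n' where n': "n = Suc n'" by (cases n) auto
  have "\<not> k < snd (state n') v"
    using not_less_Least[of n' "\<lambda>n. k < snd (state n) v"] n' unfolding n_def by simp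
  then have "position n' = v \<and> snd (state n') v = k"
    using n unfolding n' count_Suc by (auto split: if_splits)
  then show ?thesis by blast
qed

lemma visited_infinitely_often_step:
  assumes inf: "infinite {n. position n = v}" and v: "v \<in> verts G - targets"
    and a: "a \<in> range (rotor v)"
  shows "infinite {n. position n = head G a}"
proof -
  obtain k0 where k0: "a = rotor v k0" using a by blast
  obtain p where p: "p > 0" "\<And>n. rotor v (n + p) = rotor v n"
    using rotor_periodic[OF v] unfolding periodic_def by blast
  have rot: "rotor v (k0 + i * p) = a" for i
  proof (induction i)
    case (Suc i)
    then show ?case using p(2)[of "k0 + i * p"] by (simp add: algebra_simps)
  qed (simp add: k0)
  obtain f where f: "\<And>k. position (f k) = v" "\<And>k. snd (state (f k)) v = k"
    using visit_with_count[OF inf] v by (metis DiffD2)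
  have "inj (\<lambda>i. Suc (f (k0 + i * p)))"
  proof (rule injI)
    fix i j assume "Suc (f (k0 + i * p)) = Suc (f (k0 + j * p))"
    then have "k0 + i * p = k0 + j * p" by (metis f(2) Suc_inject)
    then show "i = j" using p(1) by simp
  qed
  moreover have "range (\<lambda>i. Suc (f (k0 + i * p))) \<subseteq> {n. position n = head G a}"
    using f rot v by (auto simp: position_Suc)
  ultimately show ?thesis by (meson finite_subset finite_imageD infinite_UNIV_nat)
qed

text \<open>
  The hitting sequence may fail to exist if some rotor ignores an out-arc; if the rotors use all
  arcs, then reachability of the targets makes it exist.
\<close>

lemma hitting_sequence_exists:
  assumes all_arcs: "\<And>v. v \<in> verts G - targets \<Longrightarrow> range (rotor v) = out_arcs G v"
  shows "\<exists>h. is_hitting_sequence h"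
proof -
  have "\<exists>v\<in>verts G. infinite {n. position n = v}"
  proof (rule ccontr)
    assume "\<not> ?thesis"
    then have "finite (\<Union>v\<in>verts G. {n. position n = v})" by simp
    moreover have "(\<Union>v\<in>verts G. {n. position n = v}) = UNIV" using position_in_verts by auto
    ultimately show False by simp
  qed
  then obtain v where v: "v \<in> verts G" "infinite {n. position n = v}" by blast
  have "\<exists>t\<in>targets. infinite {n. position n = t}"
  proof (cases "v \<in> targets")
    case False
    then obtain t where t: "t \<in> targets" "v \<rightarrow>\<^sup>*\<^bsub>G\<^esub> t" using target_reachable v by blast
    from t(2) have "infinite {n. position n = t} \<or> (\<exists>t\<in>targets. infinite {n. position n = t})"
    proof (induction rule: reachable_induct)
      case (step x y)
      show ?case
      proof (cases "\<exists>t\<in>targets. infinite {n. position n = t}")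
        case no: False
        with step have x: "infinite {n. position n = x}" "x \<notin> targets" by auto
        obtain a where a: "a \<in> arcs G" "tail G a = x" "head G a = y"
          using step(2) by (auto simp: arcs_ends_def arc_to_ends_def)
        then have "x \<in> verts G - targets" using x by auto
        moreover have "a \<in> out_arcs G x" using a by simp
        ultimately show ?thesis
          using visited_infinitely_often_step[OF x(1)] all_arcs a(3) by blast
      qed simp
    qed (use v in simp)
    then show ?thesis using t(1) by blast
  qed (use v in blast)
  then obtain t where "t \<in> targets" "infinite {n. position n = t}" by blast
  then have "infinite {n. position n \<in> targets}"
    by (auto elim!: contrapos_nn intro: finite_subset[rotated])
  then show ?thesis using hitting_sequence_iff_infinite by simp
qed

end

end

(*
  Count the visits to every vertex before the n-th visit to the source. At such a moment every
  arrival at a vertex v other than the source has used an arc into v, and which arcs out of u have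
  been used depends only on the number of visits to u. Hence, if the visits to all in-neighbours
  of v grow by a constant (depending on the neighbour) in every k excursions from the source, then
  the visits to v grow by a constant in every |r| k excursions. Since all cycles pass through the
  source, extending simple paths shows by induction that d such steps cover all targets. So every
  |r|^d excursions hit each target the same number of times, and the total number of these hits,
  at most |r|^d as each excursion hits at most once, is a period of the hitting sequence.
*)
theory Submission
  imports Defs
begin

section \<open>Counting occurrences in prefixes of sequences\<close>

lemma card_less_Suc_pred:
  "card {i. i < Suc n \<and> P i} = card {i. i < n \<and> P i} + (if P n then 1 else 0)"
proof -
  have "{i. i < Suc n \<and> P i} = (if P n then insert n else id) {i. i < n \<and> P i}"
    by (auto simp: less_Suc_eq)
  then show ?thesis by simp
qed

text \<open>Moving a window of length \<open>p\<close> by one place drops \<open>f n\<close> and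
  gains the equal term \<open>f (n + p)\<close>, so all such windows contain \<open>x\<close>
  equally often.\<close>

lemma card_prefix_add_mult_period:
  fixes f :: "nat \<Rightarrow> 'a"
  assumes per: "\<And>i. f (i + p) = f i"
  shows "card {i. i < n + c * p \<and> f i = x} = card {i. i < n \<and> f i = x} + c * card {i. i < p \<and> f i = x}"
proof -
  have one: "card {i. i < n + p \<and> f i = x} = card {i. i < n \<and> f i = x} + card {i. i < p \<and> f i = x}" for n
  proof (induction n)
    case (Suc n)
    then show ?case using per[of n] by (simp add: card_less_Suc_pred)
  qed simp
  show ?thesis
  proof (induction c)
    case (Suc c)
    then show ?case using one[of "n + c * p"] by (simp add: algebra_simps)
  qed simp
qed

lemma add_mult_shift:
  fixes f :: "nat \<Rightarrow> nat"
  assumes "\<And>n. f (n + k) = f n + c"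
  shows "f (n + i * k) = f n + i * c"
proof (induction i)
  case (Suc i)
  then show ?case using assms[of "n + i * k"] by (simp add: algebra_simps)
qed simp

text \<open>The values of \<open>f\<close> below \<open>n\<close> are the image of an initial
  segment of indices, whose length is their number. This translates bounds on times into bounds on
  indices.\<close>

lemma less_iff_less_card_range_less:
  fixes f :: "nat \<Rightarrow> nat"
  assumes f: "strict_mono f"
  shows "f i < n \<longleftrightarrow> i < card {x. x < n \<and> x \<in> range f}"
proof -
  define m where "m = (LEAST i. n \<le> f i)"
  have "n \<le> f m"
    unfolding m_def using strict_mono_imp_increasing[OF f] by (rule LeastI)
  have less_iff: "f i < n \<longleftrightarrow> i < m" for i
  proof
    assume "f i < n"
    then show "i < m"
      using \<open>n \<le> f m\<close> strict_mono_less[OF f, of i m] by simp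
  next
    assume "i < m"
    then show "f i < n"
      using not_less_Least[of i "\<lambda>i. n \<le> f i"] by (simp add: m_def)
  qed
  have "{x. x < n \<and> x \<in> range f} = f ` {..<m}" using less_iff by auto
  then show ?thesis
    using less_iff strict_mono_imp_inj_on[OF f] by (simp add: card_image inj_on_subset)
qed

section \<open>Visits to a vertex as uses of its incoming arcs\<close>

context rotor_router_network
begin

text \<open>Targets are counted too, whereas their counters in \<open>state\<close> stay 0.\<close>

definition visits :: "'v \<Rightarrow> nat \<Rightarrow> nat" where
  "visits v n = card {i. i < n \<and> position i = v}"

definition source_time :: "nat \<Rightarrow> nat" where
  "source_time = enumerate {i. position i = source}"

lemma position_0 [simp]: "position 0 = source"
  by (simp add: position_def)

lemma visits_0 [simp]: "visits v 0 = 0"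
  by (simp add: visits_def)

lemma visits_Suc: "visits v (Suc n) = visits v n + (if position n = v then 1 else 0)"
  unfolding visits_def by (rule card_less_Suc_pred)

lemma snd_state_eq_visits: "v \<notin> targets \<Longrightarrow> snd (state n) v = visits v n"
  by (simp add: count_card visits_def)

lemma tail_not_target: "e \<in> arcs G \<Longrightarrow> tail G e \<notin> targets"
  using target_sink[of "tail G e"] finite_out_arcs[of "tail G e"] in_out_arcs_conv[of e G "tail G e"]
  by (auto simp: out_degree_def simp del: in_out_arcs_conv)

text \<open>Only the start and the returns from targets are arrivals without an arc, and both are at
  the source. The times differ by one because a departure before time \<open>k\<close> arrives by
  time \<open>k\<close>.\<close>

lemma visits_Suc_eq_arc_uses:
  assumes "v \<noteq> source"
  shows "visits v (Suc k) =
    (\<Sum>e\<in>in_arcs G v. card {i. i < visits (tail G e) k \<and> rotor (tail G e) i = e})"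
proof (induction k)
  case 0
  then show ?case using assms by (simp add: visits_Suc)
next
  case (Suc k)
  define u where "u = position k"
  show ?case
  proof (cases "u \<in> targets")
    case True
    then have "visits (tail G e) (Suc k) = visits (tail G e) k" if "e \<in> in_arcs G v" for e
      using that tail_not_target[of e] by (auto simp: visits_Suc u_def)
    then show ?thesis
      using Suc True assms by (simp add: visits_Suc[of v "Suc k"] position_Suc u_def)
  next
    case False
    define a where "a = rotor u (visits u k)"
    have u: "u \<in> verts G - targets" using False position_in_verts u_def by auto
    have a: "a \<in> arcs G" "tail G a = u" using rotor_out_arcs[OF u] by (auto simp: a_def)
    have pos: "position (Suc k) = head G a"
      using False by (simp add: position_Suc snd_state_eq_visits a_def u_def)
    \<comment> \<open>The new index \<open>visits u k\<close> carries the rotor value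
      \<open>a\<close>, so the other arcs out of \<open>u\<close> gain no use although
      \<open>visits u\<close> grows.\<close>
    have "card {i. i < visits (tail G e) (Suc k) \<and> rotor (tail G e) i = e} =
       card {i. i < visits (tail G e) k \<and> rotor (tail G e) i = e} + (if e = a then 1 else 0)" for e
      using a by (auto simp: visits_Suc card_less_Suc_pred a_def u_def)
    then have "(\<Sum>e\<in>in_arcs G v. card {i. i < visits (tail G e) (Suc k) \<and> rotor (tail G e) i = e}) =
      visits v (Suc k) + (if a \<in> in_arcs G v then 1 else 0)"
      using Suc by (simp add: sum.distrib sum.delta[OF finite_in_arcs])
    also have "\<dots> = visits v (Suc (Suc k))"
      using pos a by (simp add: visits_Suc[of v "Suc k"])
    finally show ?thesis by simp
  qed
qed

section \<open>Visit counts at the returns to the source\<close>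

context
  assumes inf: "infinite {i. position i = source}"
begin

lemma position_source_time: "position (source_time n) = source"
  using enumerate_in_set[OF inf] by (simp add: source_time_def)

lemma strict_mono_source_time: "strict_mono source_time"
  using strict_mono_enumerate[OF inf] by (simp add: source_time_def)

lemma range_source_time: "range source_time = {i. position i = source}"
  using range_enumerate[OF inf] by (simp add: source_time_def)

lemma source_time_0: "source_time 0 = 0"
  by (simp add: source_time_def enumerate_0 Least_eq_0)

lemma source_before_source_time: "{i. i < source_time n \<and> position i = source} = source_time ` {..<n}"
proof -
  have "{i. i < source_time n \<and> position i = source} = {i \<in> range source_time. i < source_time n}"
    unfolding range_source_time by auto
  also have "\<dots> = source_time ` {..<n}"
    using strict_mono_less[OF strict_mono_source_time] by auto
  finally show ?thesis .
qed

lemma visits_source: "visits source (source_time n) = n"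
  using strict_mono_imp_inj_on[OF strict_mono_source_time]
  by (simp add: visits_def source_before_source_time card_image inj_on_subset)

text \<open>At these moments the particle is at the source and not at \<open>v\<close>, so the shift
  by one time step disappears.\<close>

lemma visits_eq_arc_uses:
  assumes "v \<noteq> source"
  shows "visits v (source_time n) =
    (\<Sum>e\<in>in_arcs G v. card {i. i < visits (tail G e) (source_time n) \<and> rotor (tail G e) i = e})"
  using visits_Suc_eq_arc_uses[OF assms, of "source_time n"] assms
  by (simp add: visits_Suc[of v] position_source_time)

text \<open>In \<open>p * k\<close> excursions the tail of \<open>e\<close> is visited
  \<open>C e * p\<close> more times, which is a whole number of rotor periods. The additional uses
  of \<open>e\<close> therefore do not depend on where in its period the rotor stood.\<close>

lemma visits_shift_of_in_neighbours:
  assumes per: "\<And>v n. v \<in> verts G - targets \<Longrightarrow> rotor v (n + p) = rotor v n"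
    and v: "v \<noteq> source"
    and shift: "\<And>e. e \<in> in_arcs G v \<Longrightarrow>
      \<exists>c. \<forall>n. visits (tail G e) (source_time (n + k)) = visits (tail G e) (source_time n) + c"
  shows "\<exists>c. \<forall>n. visits v (source_time (n + p * k)) = visits v (source_time n) + c"
proof -
  obtain C where C: "\<And>e n. e \<in> in_arcs G v \<Longrightarrow>
      visits (tail G e) (source_time (n + k)) = visits (tail G e) (source_time n) + C e"
    using shift by metis
  have "visits v (source_time (n + p * k)) = visits v (source_time n) +
      (\<Sum>e\<in>in_arcs G v. C e * card {i. i < p \<and> rotor (tail G e) i = e})" for n
  proof -
    have "card {i. i < visits (tail G e) (source_time (n + p * k)) \<and> rotor (tail G e) i = e} =
        card {i. i < visits (tail G e) (source_time n) \<and> rotor (tail G e) i = e} +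
        C e * card {i. i < p \<and> rotor (tail G e) i = e}" if e: "e \<in> in_arcs G v" for e
    proof -
      have "tail G e \<in> verts G - targets" using e tail_not_target by auto
      then have "rotor (tail G e) (i + p) = rotor (tail G e) i" for i by (rule per)
      moreover have "visits (tail G e) (source_time (n + p * k)) =
          visits (tail G e) (source_time n) + C e * p"
        using add_mult_shift[of "\<lambda>n. visits (tail G e) (source_time n)" k "C e" n p] C[OF e]
        by (simp add: mult.commute)
      ultimately show ?thesis
        using card_prefix_add_mult_period[of "rotor (tail G e)" p] by simp
    qed
    then show ?thesis by (simp add: visits_eq_arc_uses[OF v] sum.distrib)
  qed
  then show ?thesis by blast
qed

end

section \<open>Simple paths from the source and induction along them\<close>

lemma position_reachable: "source \<rightarrow>\<^sup>*\<^bsub>G\<^esub> position n"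
proof (induction n)
  case 0
  then show ?case by (simp add: source_in_verts)
next
  case (Suc n)
  show ?case
  proof (cases "position n \<in> targets")
    case True
    then show ?thesis by (simp add: position_Suc source_in_verts)
  next
    case False
    define a where "a = rotor (position n) (snd (state n) (position n))"
    have "a \<in> out_arcs G (position n)"
      unfolding a_def using False position_in_verts by (intro rotor_out_arcs) auto
    then have "position n \<rightarrow>\<^bsub>G\<^esub> head G a" using in_arcs_imp_in_arcs_ends[of a] by simp
    then show ?thesis
      using Suc False reachable_adj_trans by (simp add: position_Suc a_def)
  qed
qed

lemma last_in_awalk_verts: "awalk u p v \<Longrightarrow> v \<in> set (awalk_verts u p)"
  by (metis awalk_def awlast_if_cas awalk_verts_non_Nil last_in_set)

text \<open>If the head of \<open>e\<close> were already on \<open>p\<close>, the rest of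
  \<open>p\<close> from there on would close up with \<open>e\<close> to a cycle, which must contain
  the source. But the simple path \<open>p\<close> meets the source only at its beginning.\<close>

lemma apath_snoc:
  assumes through_source: "\<And>c. cycle c \<Longrightarrow> source \<in> tail G ` set c"
    and p: "apath source p (tail G e)" and e: "e \<in> arcs G" and v: "head G e \<noteq> source"
  shows "apath source (p @ [e]) (head G e)"
    and "set (awalk_verts source (p @ [e])) = insert (head G e) (set (awalk_verts source p))"
    and "head G e \<notin> set (awalk_verts source p)"
proof -
  have w: "awalk source p (tail G e)" using p by (simp add: apath_def)
  have we: "awalk (tail G e) [e] (head G e)" using e by (simp add: arc_implies_awalk)
  have verts_snoc: "awalk_verts x (q @ [e]) = awalk_verts x q @ [head G e]"
    if "awalk x q (tail G e)" for x q
    using awalk_verts_append[OF awalk_appendI[OF that we]] that by simp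
  show "set (awalk_verts source (p @ [e])) = insert (head G e) (set (awalk_verts source p))"
    using verts_snoc[OF w] by simp
  show new: "head G e \<notin> set (awalk_verts source p)"
  proof
    assume "head G e \<in> set (awalk_verts source p)"
    then obtain q s where qs: "p = q @ s" "awalk source q (head G e)" "awalk (head G e) s (tail G e)"
      using awalk_decomp[OF w] by blast
    have ap: "apath (head G e) s (tail G e)"
      "set (awalk_verts source q) \<inter> set (tl (awalk_verts (head G e) s)) = {}"
      using p qs unfolding qs(1) apath_append_iff by auto
    have vs: "awalk_verts (head G e) (s @ [e]) = awalk_verts (head G e) s @ [head G e]"
      using verts_snoc[OF qs(3)] .
    have hd: "awalk_verts (head G e) s = head G e # tl (awalk_verts (head G e) s)"
      using awhd_of_awalk[OF qs(3)] by (metis awalk_verts_non_Nil list.collapse)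
    have "distinct (awalk_verts (head G e) s)" using ap(1) by (simp add: apath_def)
    then have "head G e \<notin> set (tl (awalk_verts (head G e) s))"
      "distinct (tl (awalk_verts (head G e) s))"
      by (subst (asm) hd, simp)+
    then have "cycle (s @ [e])"
      unfolding cycle_def using awalk_appendI[OF qs(3) we] vs
      by (intro exI[of _ "head G e"]) simp
    then have "source \<in> tail G ` set (s @ [e])" by (rule through_source)
    then have "source \<in> set (awalk_verts (head G e) s)"
      using last_in_awalk_verts[OF qs(3)] by (auto simp: set_awalk_verts[OF qs(3)])
    \<comment> \<open>The first vertex of \<open>s\<close> is the head of \<open>e\<close>, hence
      not the source; any later vertex of \<open>s\<close> is absent from \<open>q\<close>, which
      begins at the source.\<close>
    then have "source \<in> set (tl (awalk_verts (head G e) s))"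
      using v hd by (metis set_ConsD)
    moreover have "source \<in> set (awalk_verts source q)" using qs(2) by (rule hd_in_awalk_verts)
    ultimately show False using ap(2) by blast
  qed
  show "apath source (p @ [e]) (head G e)"
    using p new verts_snoc[OF w] awalk_appendI[OF w we] by (simp add: apath_def)
qed

text \<open>Induction on the bound for simple paths ending at \<open>v\<close>: passing to an
  in-neighbour lowers the bound by one, and coming back costs one factor \<open>p\<close>. At the
  source itself the count is simply the number of excursions.\<close>

lemma visits_shift:
  assumes inf: "infinite {i. position i = source}"
    and source: "source \<notin> targets"
    and through_source: "\<And>c. cycle c \<Longrightarrow> source \<in> tail G ` set c"
    and per: "\<And>v n. v \<in> verts G - targets \<Longrightarrow> rotor v (n + p) = rotor v n"
    and "v \<in> verts G - targets"
    and "\<And>q. apath source q v \<Longrightarrow> card (set (awalk_verts source q) - targets) \<le> Suc j"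
  shows "\<exists>c. \<forall>n. visits v (source_time (n + p ^ j)) = visits v (source_time n) + c"
  using assms(5,6)
proof (induction j arbitrary: v)
  case 0
  show ?case
  proof (cases "v = source")
    case True
    then show ?thesis by (auto simp: visits_source[OF inf])
  next
    case False
    \<comment> \<open>A path to \<open>v\<close> would contain two non-targets,
      \<open>source\<close> and \<open>v\<close>, against the bound 1. So \<open>v\<close> is never
      visited and the constant is 0.\<close>
    have "\<not> source \<rightarrow>\<^sup>*\<^bsub>G\<^esub> v"
    proof
      assume "source \<rightarrow>\<^sup>*\<^bsub>G\<^esub> v"
      then obtain q where q: "apath source q v" using reachable_apath by blast
      then have w: "awalk source q v" by (simp add: apath_def)
      have "{source, v} \<subseteq> set (awalk_verts source q) - targets"
        using source 0(1) hd_in_awalk_verts(1)[OF w] last_in_awalk_verts[OF w] by simp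
      then have "card {source, v} \<le> card (set (awalk_verts source q) - targets)"
        by (intro card_mono) auto
      then show False using 0(2)[OF q] False by simp
    qed
    then have "position i \<noteq> v" for i using position_reachable by metis
    then show ?thesis by (simp add: visits_def)
  qed
next
  case (Suc j)
  show ?case
  proof (cases "v = source")
    case True
    then show ?thesis by (auto simp: visits_source[OF inf])
  next
    case False
    have "\<exists>c. \<forall>n. visits v (source_time (n + p * p ^ j)) = visits v (source_time n) + c"
    proof (rule visits_shift_of_in_neighbours[OF inf per False])
      fix e assume "e \<in> in_arcs G v"
      then have e: "e \<in> arcs G" "head G e = v" by auto
      show "\<exists>c. \<forall>n. visits (tail G e) (source_time (n + p ^ j)) = visits (tail G e) (source_time n) + c"
      proof (rule Suc.IH)
        show "tail G e \<in> verts G - targets" using e tail_not_target by simp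
        fix q assume q: "apath source q (tail G e)"
        note snoc = apath_snoc[OF through_source q e(1)]
        have "card (set (awalk_verts source (q @ [e])) - targets) \<le> Suc (Suc j)"
          using snoc(1) False e(2) by (intro Suc.prems(2)) simp
        moreover have "set (awalk_verts source (q @ [e])) - targets =
            insert v (set (awalk_verts source q) - targets)"
          using snoc(2) False e(2) Suc.prems(1) by auto
        moreover have "v \<notin> set (awalk_verts source q) - targets"
          using snoc(3) False e(2) by auto
        ultimately show "card (set (awalk_verts source q) - targets) \<le> Suc j" by simp
      qed
    qed
    then show ?thesis by simp
  qed
qed

section \<open>From visits to targets to a period of the hitting sequence\<close>

definition hits :: "nat \<Rightarrow> nat" where
  "hits n = card {i. i < n \<and> position i \<in> targets}"

lemma infinite_source_visits:
  assumes "is_hitting_sequence h"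
  shows "infinite {i. position i = source}"
proof -
  have "infinite {n. position n \<in> targets}"
    using assms hitting_sequence_iff_infinite by blast
  then have "infinite (Suc ` {n. position n \<in> targets})" by (simp add: finite_image_iff)
  moreover have "Suc ` {n. position n \<in> targets} \<subseteq> {i. position i = source}"
    by (auto simp: position_Suc)
  ultimately show ?thesis using finite_subset by blast
qed

text \<open>Each hit is followed at once by a visit to the source, at positive time and hence with
  index at least 1; distinct hits give distinct indices up to \<open>n\<close>.\<close>

lemma hits_source_time_le:
  assumes inf: "infinite {i. position i = source}"
  shows "hits (source_time n) \<le> n"
proof -
  let ?T = "{i. i < source_time n \<and> position i \<in> targets}"
  have "Suc ` ?T \<subseteq> source_time ` {1..n}"
  proof
    fix x assume "x \<in> Suc ` ?T"
    then have x: "0 < x" "x \<le> source_time n" "position x = source" by (auto simp: position_Suc)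
    then obtain k where k: "x = source_time k" using range_source_time[OF inf] by blast
    then have "k \<le> n" "k \<noteq> 0"
      using x strict_mono_less_eq[OF strict_mono_source_time[OF inf]] source_time_0[OF inf]
      by (auto intro: gr0I)
    then show "x \<in> source_time ` {1..n}" using k by auto
  qed
  then have "card (Suc ` ?T) \<le> card {1..n}" by (rule surj_card_le[rotated]) simp
  then show ?thesis by (simp add: hits_def card_image)
qed

text \<open>The occurrences of each target in a prefix of \<open>h\<close> grow by a constant when
  the prefix is lengthened by \<open>C\<close>, the number of hits in any \<open>P\<close>
  excursions. Comparing the prefixes of lengths \<open>k\<close> and \<open>Suc k\<close> then
  yields the period \<open>C\<close>.\<close>

lemma hitting_sequence_shift:
  assumes h: "is_hitting_sequence h" and P: "P > 0"
    and shift: "\<And>t. t \<in> targets \<Longrightarrow>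
      \<exists>c. \<forall>n. visits t (source_time (n + P)) = visits t (source_time n) + c"
  shows "\<exists>C>0. C \<le> P \<and> (\<forall>k. h (k + C) = h k)"
proof -
  note inf = infinite_source_visits[OF h]
  have fin: "finite targets" using targets_in_verts finite_verts finite_subset by blast
  obtain \<tau> where \<tau>: "strict_mono \<tau>" "range \<tau> = {n. position n \<in> targets}" "h = position \<circ> \<tau>"
    using h unfolding is_hitting_sequence_def by blast
  have hit: "h i \<in> targets" for i using \<tau> by auto
  have hits_\<tau>: "hits (Suc (\<tau> k)) = Suc k" for k
  proof -
    have "{i. i < Suc (\<tau> k) \<and> position i \<in> targets} = {i \<in> range \<tau>. i \<le> \<tau> k}"
      unfolding \<tau>(2) by auto
    also have "\<dots> = \<tau> ` {..k}" using strict_mono_less_eq[OF \<tau>(1)] by auto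
    finally show ?thesis
      using strict_mono_imp_inj_on[OF \<tau>(1)] by (simp add: hits_def card_image inj_on_subset)
  qed
  \<comment> \<open>Since a return to the source directly follows every hit, each prefix length of
    \<open>h\<close> is attained at a source time, where the shift hypothesis applies.\<close>
  have onto: "\<exists>n. hits (source_time n) = k" for k
  proof (cases k)
    case 0
    then show ?thesis by (intro exI[of _ 0]) (simp add: hits_def source_time_0[OF inf])
  next
    case (Suc j)
    have "position (\<tau> j) \<in> targets" using \<tau>(2) by blast
    then have "Suc (\<tau> j) \<in> range source_time"
      unfolding range_source_time[OF inf] by (simp add: position_Suc)
    then show ?thesis using hits_\<tau>[of j] Suc by (metis rangeE)
  qed
  have visits_h: "visits t n = card {i. i < hits n \<and> h i = t}" if t: "t \<in> targets" for t n
  proof -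
    have lt: "\<tau> i < n \<longleftrightarrow> i < hits n" for i
      using less_iff_less_card_range_less[OF \<tau>(1), of i n] \<tau>(2) by (simp add: hits_def)
    have "{m. m < n \<and> position m = t} = \<tau> ` {i. i < hits n \<and> h i = t}"
    proof -
      have "{m. m < n \<and> position m = t} = {m \<in> range \<tau>. m < n \<and> position m = t}"
        unfolding \<tau>(2) using t by auto
      also have "\<dots> = \<tau> ` {i. i < hits n \<and> h i = t}" using lt \<tau>(3) by auto
      finally show ?thesis .
    qed
    then show ?thesis
      using strict_mono_imp_inj_on[OF \<tau>(1)] by (simp add: visits_def card_image inj_on_subset)
  qed
  obtain c where c: "\<And>t n. t \<in> targets \<Longrightarrow>
      visits t (source_time (n + P)) = visits t (source_time n) + c t"
    using shift by metis
  have sum_visits: "hits n = (\<Sum>t\<in>targets. visits t n)" for n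
  proof -
    have "{i. i < n \<and> position i \<in> targets} = (\<Union>t\<in>targets. {i. i < n \<and> position i = t})" by auto
    then show ?thesis
      unfolding hits_def visits_def using fin by (simp add: card_UN_disjoint disjoint_iff)
  qed
  define C where "C = (\<Sum>t\<in>targets. c t)"
  have shift_hits: "hits (source_time (n + P)) = hits (source_time n) + C" for n
    by (simp add: sum_visits C_def c sum.distrib)
  have hits_0: "hits (source_time 0) = 0" by (simp add: source_time_0[OF inf] hits_def)
  have "C \<le> P" using shift_hits[of 0] hits_0 hits_source_time_le[OF inf, of P] by simp
  moreover have "C > 0"
  proof (rule ccontr)
    \<comment> \<open>Otherwise no hit would precede any of the times
      \<open>source_time (n * P)\<close>, although these exceed every bound and a first hit
      exists.\<close>
    assume "\<not> C > 0"
    then have zero: "hits (source_time (n * P)) = 0" for n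
      using add_mult_shift[of "\<lambda>n. hits (source_time n)" P C 0 n] shift_hits hits_0 by simp
    obtain n where n: "hits (source_time n) = 1" using onto by blast
    have "source_time n \<le> source_time (n * P)"
      using strict_mono_less_eq[OF strict_mono_source_time[OF inf]] P by simp
    then have "hits (source_time n) \<le> hits (source_time (n * P))"
      unfolding hits_def by (intro card_mono) auto
    then show False using n zero by simp
  qed
  moreover have "h (k + C) = h k" for k
  proof -
    have shift_h: "card {i. i < k + C \<and> h i = h l} = card {i. i < k \<and> h i = h l} + c (h l)" for k l
    proof -
      obtain n where n: "hits (source_time n) = k" using onto by blast
      show ?thesis
        using c[OF hit, of l n] unfolding visits_h[OF hit] shift_hits n .
    qed
    \<comment> \<open>The count of \<open>h k\<close> rises at index \<open>k\<close>, so it must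
      also rise at index \<open>k + C\<close>.\<close>
    show ?thesis
      using shift_h[of "Suc k" k] shift_h[of k k]
      by (simp add: card_less_Suc_pred split: if_splits)
  qed
  ultimately show ?thesis by blast
qed

end

theorem theorem5p4:
  fixes G :: "('v, 'e) pre_digraph"
    and source :: 'v and targets :: "'v set" and rotor :: "'v \<Rightarrow> nat \<Rightarrow> 'e"
    and r :: "nat \<Rightarrow> nat" and h :: "nat \<Rightarrow> 'v" and m d :: nat
  assumes network: "rotor_router_network G source targets rotor"
    and "m = card (verts G - targets)"
    and "periodic r"
    and "\<And>v. v \<in> verts G - targets \<Longrightarrow>
           rotor_router_network.has_rotor_of_type G rotor r v"
    and "\<And>c. pre_digraph.cycle G c \<Longrightarrow> source \<in> tail G ` set c"
    and "d = Max {card (set (pre_digraph.awalk_verts G source p) - targets) | p v.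
                    pre_digraph.apath G source p v}"
    and "rotor_router_network.is_hitting_sequence G source targets rotor h"
  shows "periodic h \<and> fundamental_period h \<le> fundamental_period r ^ d"
proof -
  interpret rotor_router_network G source targets rotor by (rule network)
  define p where "p = fundamental_period r"
  have p: "0 < p \<and> (\<forall>n. r (n + p) = r n)"
    unfolding p_def fundamental_period_def
    by (rule LeastI_ex[of "\<lambda>p. 0 < p \<and> (\<forall>n. r (n + p) = r n)"])
      (use assms(3) periodic_def in blast)
  have per: "rotor v (n + p) = rotor v n" if "v \<in> verts G - targets" for v n
    using assms(4)[OF that] p unfolding has_rotor_of_type_def by auto
  have "\<exists>C>0. C \<le> p ^ d \<and> (\<forall>k. h (k + C) = h k)"
  proof (cases "source \<in> targets")
    \<comment> \<open>The particle stays at the source forever, so \<open>h\<close> is constant and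
      1 is a period.\<close>
    case True
    have "position n = source" for n
      by (induction n) (use True in \<open>auto simp: position_Suc\<close>)
    then have "h k = source" for k
      using assms(7) unfolding is_hitting_sequence_def by auto
    then show ?thesis using p by (intro exI[of _ 1]) simp
  next
    case source: False
    let ?D = "{card (set (awalk_verts source q) - targets) | q v. apath source q v}"
    \<comment> \<open>Finiteness makes \<open>Max\<close> a genuine upper bound.\<close>
    have "?D \<subseteq> {..card (verts G)}"
      using awalk_verts_in_verts by (fastforce simp: apath_def intro: card_mono)
    then have fin: "finite ?D" using finite_subset by blast
    have le_d: "card (set (awalk_verts source q) - targets) \<le> d" if "apath source q v" for q v
      unfolding assms(6) using that by (intro Max_ge[OF fin]) blast
    \<comment> \<open>The empty path already has the non-target \<open>source\<close>, so one factor
      \<open>p\<close> can be split off \<open>p ^ d\<close>.\<close>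
    have "apath source [] source" by (simp add: apath_Nil_iff source_in_verts)
    then have "d \<ge> 1" using le_d[of "[]" source] source by (simp add: insert_Diff_if)
    then obtain j where j: "d = Suc j" by (cases d) auto
    note inf = infinite_source_visits[OF assms(7)]
    show ?thesis
    proof (rule hitting_sequence_shift[OF assms(7)])
      show "p ^ d > 0" using p by simp
      fix t assume t: "t \<in> targets"
      \<comment> \<open>All tails of arcs into \<open>t\<close> are non-targets, whose visits shift
        after \<open>p ^ j\<close> excursions; the last factor \<open>p\<close> carries this over to
        \<open>t\<close>.\<close>
      have "\<exists>c. \<forall>n. visits t (source_time (n + p * p ^ j)) = visits t (source_time n) + c"
      proof (rule visits_shift_of_in_neighbours[OF inf per])
        show "t \<noteq> source" using t source by auto
        fix e assume "e \<in> in_arcs G t"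
        then have "tail G e \<in> verts G - targets" using tail_not_target by auto
        then show "\<exists>c. \<forall>n. visits (tail G e) (source_time (n + p ^ j)) =
            visits (tail G e) (source_time n) + c"
          using le_d j by (intro visits_shift[OF inf source assms(5) per]) auto
      qed
      then show "\<exists>c. \<forall>n. visits t (source_time (n + p ^ d)) = visits t (source_time n) + c"
        using j by simp
    qed
  qed
  then obtain C where C: "0 < C" "C \<le> p ^ d" "\<forall>k. h (k + C) = h k" by blast
  then have "fundamental_period h \<le> C" unfolding fundamental_period_def by (intro Least_le) simp
  then show ?thesis using C unfolding periodic_def p_def by (meson le_trans)
qed

end
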